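(* There exists an absolute constant $c>0$ such that for every finite convex set $A\subset\mathbb{R}$ with $|A|\geq 2$ the following three inequalities hold: $$|A-A|\geq c\,|A|^{8/5}(\log |A|)^{-2/5},$$ $$|A+A|\geq c\,|A|^{14/9}(\log |A|)^{-2/3},$$ $$|A+A|^3\,|A-A|^2\,(\log |A|)^{2}\geq c\,|A|^8 .$$
   Context: A finite set of real numbers $A=\{a_1,\dots,a_n\}$ with $a_i<a_{i+1}$ for all $i$ is called convex if $a_{i+1}-a_i>a_i-a_{i-1}$ for every $i=2,\dots,n-1$. Here $A+A=\{a+a' : a,a'\in A\}$, $A-A=\{a-a' : a,a'\in A\}$, and $|X|$ denotes the cardinality of a finite set $X$. *)

theory Defs
  imports "HOL-Analysis.Analysis" "HOL-Library.Set_Algebras"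
begin

(* Convexity in the sense of additive combinatorics (strictly increasing consecutive gaps);
   unrelated to the library predicate convex. *)
definition convex_finite_set :: "real set \<Rightarrow> bool" where
  "convex_finite_set A \<longleftrightarrow>
     (\<exists>(n::nat) (a::nat \<Rightarrow> real).
        A = a ` {1..n} \<and>
        (\<forall>i\<in>{1..<n}. a i < a (i + 1)) \<and>
        (\<forall>i\<in>{2..<n}. a (i + 1) - a i > a i - a (i - 1)))"

(* On sets the library's - is set-theoretic difference, so the pointwise difference set needs
   its own constant.  The sumset is the pointwise + of Set_Algebras. *)
definition difference_set :: "real set \<Rightarrow> real set \<Rightarrow> real set" where
  "difference_set A B = {a - b | a b. a \<in> A \<and> b \<in> B}"

end

theory Submission
  imports Defs
begin

text \<open>
  Write \<open>r\<^bsub>A-B\<^esub>(x)\<close> for the number of representations \<open>x = a - b\<close> with \<open>a \<in> A\<close>, \<open>b \<in> B\<close>, let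
  \<open>A\<^sub>s = A \<inter> (A - s)\<close> and \<open>r(s) = |A\<^sub>s|\<close>, the number of representations in \<open>A - A\<close>, and put
  \<open>n = |A|\<close>, \<open>D = A - A\<close>, \<open>S = A + A\<close>. Convexity enters only through a bound on popular
  differences (\<open>convex_card_popular_le\<close>): for every finite \<open>B\<close>, at most \<open>64 |A| |B|\<^sup>2 / t\<^sup>3\<close> values
  \<open>x\<close> have \<open>r\<^bsub>A-B\<^esub>(x) \<ge> t\<close>. It follows from an elementary squeezing argument rather than from
  incidence geometry. A popular \<open>x\<close> has many pairs of neighbouring representations whose
  elements are close to each other both in the ordering of \<open>A\<close> and in that of \<open>B\<close>. In a convex
  set a difference \<open>a\<^sub>j - a\<^sub>i\<close> together with the index gap \<open>j - i\<close> determines \<open>i\<close>, so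
  such a pair is recovered from one element of \<open>B\<close> and two small gaps. This limits the number
  of pairs, hence the number of popular \<open>x\<close>.

  Summing over \<open>t\<close> gives \<open>\<Sum>\<^sub>s r(s)\<^sup>3 \<lesssim> n\<^sup>3 log n\<close> and, for the additive energy \<open>E(A,V)\<close>,
  \<open>E(A,V) \<lesssim> n |V| powr (3/2)\<close>. The link to sum and difference sets consists of three
  observations.

  \<^item> \<open>\<Sum>\<^sub>s E(A, A\<^sub>s) \<le> \<Sum>\<^sub>s r(s)\<^sup>3\<close> (\<open>sum_energy_fibre_le\<close>).
  \<^item> \<open>n\<^sup>2 |A\<^sub>s|\<^sup>2 \<le> |A \<plusminus> A\<^sub>s| E(A, A\<^sub>s)\<close>, by the Cauchy-Schwarz inequality.
  \<^item> \<open>|A - A\<^sub>s| \<le> r\<^bsub>D-D\<^esub>(s)\<close> and \<open>|A + A\<^sub>s| \<le> r\<^bsub>S-S\<^esub>(s)\<close>, the Katz-Koester inclusions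
    (\<open>card_difference_fibre_le\<close>, \<open>card_sum_fibre_le\<close>).

  With \<open>T = \<Sum>\<^sub>s r(s) powr (3/2)\<close>, a further Cauchy-Schwarz step combines them into
  \<open>n\<^sup>2 T\<^sup>2 \<le> (\<Sum>\<^sub>s r(s)\<^sup>3) E(A,V)\<close> for \<open>V = D\<close> and \<open>V = S\<close> (\<open>three_halves_moment_le\<close>), so
  \<open>T\<^sup>2 \<lesssim> n\<^sup>2 log n |V| powr (3/2)\<close>. In the other direction, Hoelder's inequality gives
  \<open>n\<^sup>6 \<le> T\<^sup>2 |D|\<close> and \<open>(\<Sum>\<^sub>s r(s)\<^sup>2)\<^sup>3 \<le> T\<^sup>2 \<Sum>\<^sub>s r(s)\<^sup>3\<close>, while \<open>n\<^sup>4 \<le> |S| \<Sum>\<^sub>s r(s)\<^sup>2\<close>.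
  The first lower bound with \<open>V = D\<close> yields the inequality for \<open>A - A\<close>, the same one with
  \<open>V = S\<close> yields the mixed inequality, and the second with \<open>V = S\<close> yields the inequality for
  \<open>A + A\<close>, with \<open>(log n) powr (-4/9)\<close>, which exceeds a constant times \<open>(log n) powr (-2/3)\<close>.
\<close>

section \<open>Gaps in convex sets\<close>

definition position :: "real set \<Rightarrow> real \<Rightarrow> nat" where
  "position S y = card {z \<in> S. z < y}"

lemma position_le_card: "finite S \<Longrightarrow> position S y \<le> card S"
  unfolding position_def by (intro card_mono) auto

lemma position_mono: "finite S \<Longrightarrow> y \<le> z \<Longrightarrow> position S y \<le> position S z"
  unfolding position_def by (intro card_mono) auto

lemma position_less: "finite S \<Longrightarrow> y \<in> S \<Longrightarrow> y < z \<Longrightarrow> position S y < position S z"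
  unfolding position_def by (intro psubset_card_mono) auto

lemma position_inj:
  assumes "finite S" "y \<in> S" "z \<in> S" "position S y = position S z"
  shows "y = z"
  using position_less[OF assms(1,2), of z] position_less[OF assms(1,3), of y] assms(4)
  by (cases y z rule: linorder_cases) auto


lemma less_if_steps_less:
  fixes a :: "nat \<Rightarrow> real"
  assumes step: "\<And>i. 1 \<le> i \<Longrightarrow> i < n \<Longrightarrow> a i < a (i + 1)"
  shows "1 \<le> i \<Longrightarrow> i < j \<Longrightarrow> j \<le> n \<Longrightarrow> a i < a j"
proof (induction j)
  case (Suc j)
  then show ?case
    using step[of j] by (cases "i = j") force+
qed simp

lemma position_enumerated:
  fixes a :: "nat \<Rightarrow> real"
  assumes mono: "\<And>i j. 1 \<le> i \<Longrightarrow> i < j \<Longrightarrow> j \<le> n \<Longrightarrow> a i < a j"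
    and i: "1 \<le> i" "i \<le> n"
  shows "position (a ` {1..n}) (a i) = i - 1"
proof -
  have inj: "inj_on a {1..n}"
  proof (rule inj_onI)
    fix j k assume "j \<in> {1..n}" "k \<in> {1..n}" "a j = a k"
    then show "j = k" using mono[of j k] mono[of k j] by (cases j k rule: linorder_cases) auto
  qed
  have "{z \<in> a ` {1..n}. z < a i} = a ` {1..<i}"
  proof (intro set_eqI iffI)
    fix z assume "z \<in> {z \<in> a ` {1..n}. z < a i}"
    then obtain j where j: "j \<in> {1..n}" "z = a j" "a j < a i" by auto
    then have "j < i" using mono[of i j] i by (cases i j rule: linorder_cases) auto
    then show "z \<in> a ` {1..<i}" using j by auto
  next
    fix z assume "z \<in> a ` {1..<i}"
    then show "z \<in> {z \<in> a ` {1..n}. z < a i}" using mono i by auto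
  qed
  moreover have "card (a ` {1..<i}) = i - 1"
    using i by (subst card_image) (auto intro: inj_on_subset[OF inj])
  ultimately show ?thesis by (simp add: position_def)
qed

text \<open>
  The sum of \<open>d\<close> consecutive gaps starting at the \<open>i\<close>-th element of a convex set is strictly
  increasing in \<open>i\<close>, because the gaps themselves are. Hence the value of the sum and \<open>d\<close>
  determine \<open>i\<close>.
\<close>

lemma convex_difference_determines:
  assumes A: "convex_finite_set A"
    and mem: "y \<in> A" "y' \<in> A" "z \<in> A" "z' \<in> A"
    and less: "y < y'"
    and diff: "y' - y = z' - z"
    and gap: "position A y' - position A y = position A z' - position A z"
  shows "y = z"
proof -
  obtain n :: nat and a :: "nat \<Rightarrow> real" where Aeq: "A = a ` {1..n}"
    and inc: "\<forall>i\<in>{1..<n}. a i < a (i + 1)"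
    and conv: "\<forall>i\<in>{2..<n}. a (i + 1) - a i > a i - a (i - 1)"
    using A unfolding convex_finite_set_def by blast
  have mono: "\<And>i j. 1 \<le> i \<Longrightarrow> i < j \<Longrightarrow> j \<le> n \<Longrightarrow> a i < a j"
    by (rule less_if_steps_less[of n a]) (use inc in auto)
  define g where "g k = a (k + 1) - a k" for k
  have g_step: "g i < g (i + 1)" if "1 \<le> i" "i < n - 1" for i
    using conv[rule_format, of "i + 1"] that by (simp add: g_def)
  have g_mono: "g i < g j" if "1 \<le> i" "i < j" "j < n" for i j
    using less_if_steps_less[of "n - 1" g i j] g_step that by auto
  have tele: "a (i + d) - a i = (\<Sum>l<d. g (i + l))" for i d
    by (induction d) (auto simp: g_def)
  have wide: "a (i + d) - a i < a (j + d) - a j"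
    if "1 \<le> i" "i < j" "j + d \<le> n" "0 < d" for i j d
    unfolding tele using that by (intro sum_strict_mono g_mono) auto
  obtain i where i: "1 \<le> i" "i \<le> n" "y = a i" using mem Aeq by auto
  obtain i' where i': "1 \<le> i'" "i' \<le> n" "y' = a i'" using mem Aeq by auto
  obtain j where j: "1 \<le> j" "j \<le> n" "z = a j" using mem Aeq by auto
  obtain j' where j': "1 \<le> j'" "j' \<le> n" "z' = a j'" using mem Aeq by auto
  have ii: "i < i'" using less mono[of i' i] i i' by (cases i i' rule: linorder_cases) auto
  have jj: "j < j'" using less diff mono[of j' j] j j' by (cases j j' rule: linorder_cases) auto
  have rk: "position A (a k) = k - 1" if "1 \<le> k" "k \<le> n" for k
    unfolding Aeq using mono that by (rule position_enumerated)
  have d: "i' - i = j' - j" using gap rk i i' j j' ii jj by simp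
  define e where "e = i' - i"
  have e: "i' = i + e" "j' = j + e" "0 < e" using ii jj d by (auto simp: e_def)
  show ?thesis
  proof (cases i j rule: linorder_cases)
    case less
    then show ?thesis using wide[of i j e] e i i' j j' diff by auto
  next
    case greater
    then show ?thesis using wide[of j i e] e i i' j j' diff by auto
  qed (use i j in auto)
qed

section \<open>Squeezing: few popular differences\<close>

lemma few_long_gaps:
  fixes f :: "nat \<Rightarrow> nat"
  assumes "\<And>k. k < K \<Longrightarrow> f k \<le> f (Suc k)"
  shows "f 0 + card {k. k < K \<and> L < f (Suc k) - f k} * (L + 1) \<le> f K"
  using assms
proof (induction K)
  case (Suc K)
  let ?bad = "\<lambda>K. {k. k < K \<and> L < f (Suc k) - f k}"
  have IH: "f 0 + card (?bad K) * (L + 1) \<le> f K" using Suc by simp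
  have step: "f K \<le> f (Suc K)" using Suc.prems by simp
  show ?case
  proof (cases "L < f (Suc K) - f K")
    case True
    then have "?bad (Suc K) = insert K (?bad K)" by (auto simp: less_Suc_eq)
    then have "card (?bad (Suc K)) = card (?bad K) + 1" by simp
    then show ?thesis using IH step True by simp
  next
    case False
    then have "?bad (Suc K) = ?bad K" by (auto simp: less_Suc_eq)
    then show ?thesis using IH step by simp
  qed
qed simp

text \<open>
  A gap that exceeds the rounded-down quotient \<open>4 * N div t\<close> is longer than \<open>4 N / t\<close>, and
  all gaps together have length at most \<open>N\<close>, so fewer than \<open>t / 4\<close> gaps are that long.
  The threshold is chosen so that discarding the long gaps of two such sequences costs fewer
  than \<open>t / 2\<close> gaps.
\<close>

lemma few_long_gaps_quarter:
  fixes f :: "nat \<Rightarrow> nat"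
  assumes "\<And>k. k < K \<Longrightarrow> f k \<le> f (Suc k)" "f K \<le> N" "0 < t"
  shows "4 * card {k. k < K \<and> 4 * N div t < f (Suc k) - f k} < t"
proof (rule ccontr)
  let ?c = "card {k. k < K \<and> 4 * N div t < f (Suc k) - f k}"
  assume "\<not> 4 * ?c < t"
  then have "t * (4 * N div t + 1) \<le> 4 * ?c * (4 * N div t + 1)" by (intro mult_le_mono1) simp
  also have "\<dots> \<le> 4 * N"
    using few_long_gaps[of K f "4 * N div t"] assms(1,2) by fastforce
  also have "\<dots> < t * (4 * N div t + 1)"
    using assms(3) by (metis add.commute dividend_less_times_div mult_Suc_right plus_1_eq_Suc)
  finally show False by simp
qed

text \<open>
  The fibre over \<open>x\<close> of the subtraction map on \<open>A \<times> B\<close>, recorded by second components: its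
  cardinality is the number of representations \<open>x = a - b\<close>. In the form \<open>fibre A A s\<close> it is
  also used as the set \<open>A \<inter> (A - s)\<close>.
\<close>

definition fibre :: "real set \<Rightarrow> real set \<Rightarrow> real \<Rightarrow> real set" where
  "fibre A B x = {b \<in> B. b + x \<in> A}"

definition close_pairs :: "nat \<Rightarrow> real set \<Rightarrow> real set \<Rightarrow> real \<Rightarrow> (real \<times> real) set" where
  "close_pairs t A B x = {(b, b'). b \<in> fibre A B x \<and> b' \<in> fibre A B x \<and> b < b' \<and>
     position B b' - position B b \<le> 4 * card B div t \<and>
     position A (b' + x) - position A (b + x) \<le> 4 * card A div t}"

lemma finite_fibre [simp]: "finite B \<Longrightarrow> finite (fibre A B x)"
  by (simp add: fibre_def)

lemma finite_close_pairs: "finite B \<Longrightarrow> finite (close_pairs t A B x)"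
  by (rule finite_subset[of _ "fibre A B x \<times> fibre A B x"]) (auto simp: close_pairs_def)

text \<open>
  List the fibre increasingly. Along this list the positions in \<open>B\<close>, and the positions in
  \<open>A\<close> of the translates by \<open>x\<close>, both increase. Each of the two sequences makes fewer than
  \<open>t / 4\<close> long jumps, and there are at least \<open>t - 1\<close> neighbouring pairs, so at least \<open>t / 4\<close> of
  them are close in both senses.
\<close>

lemma many_close_pairs:
  assumes fin: "finite A" "finite B" and t: "2 \<le> t" "t \<le> card (fibre A B x)"
  shows "t \<le> 4 * card (close_pairs t A B x)"
proof -
  define P where "P = fibre A B x"
  define l where "l = sorted_list_of_set P"
  define K where "K = card P - 1"
  have finP: "finite P" using fin by (simp add: P_def)
  have len: "length l = Suc K" using t by (simp add: l_def K_def P_def)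
  have setl: "set l = P" using finP by (simp add: l_def)
  have lless: "l ! i < l ! j" if "i < j" "j \<le> K" for i j
    using sorted_wrt_nth_less[OF strict_sorted_list_of_set[of P], of i j] that len
    unfolding l_def by simp
  have lin: "l ! i \<in> P" if "i \<le> K" for i
    using that len setl by (metis le_imp_less_Suc nth_mem)
  define f where "f k = position B (l ! k)" for k
  define g where "g k = position A (l ! k + x)" for k
  define badf where "badf = {k. k < K \<and> 4 * card B div t < f (Suc k) - f k}"
  define badg where "badg = {k. k < K \<and> 4 * card A div t < g (Suc k) - g k}"
  have "l ! k \<le> l ! Suc k" if "k < K" for k using lless[of k "Suc k"] that by simp
  then have mono: "f k \<le> f (Suc k)" "g k \<le> g (Suc k)" if "k < K" for k
    unfolding f_def g_def using fin that by (simp_all add: position_mono)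
  have bad: "4 * card badf < t" "4 * card badg < t"
    unfolding badf_def badg_def
    by (rule few_long_gaps_quarter; use t fin mono in \<open>simp add: f_def g_def position_le_card\<close>)+
  define good where "good = {..<K} - (badf \<union> badg)"
  have "K - (card badf + card badg) \<le> card good"
  proof -
    have "finite (badf \<union> badg)" by (auto simp: badf_def badg_def)
    then have "K - card (badf \<union> badg) \<le> card good"
      unfolding good_def by (metis card_lessThan diff_card_le_card_Diff)
    then show ?thesis using card_Un_le[of badf badg] by linarith
  qed
  then have "t \<le> 4 * card good" using bad t by (simp add: K_def P_def)
  moreover have "card good \<le> card (close_pairs t A B x)"
  proof (rule card_inj_on_le[of "\<lambda>k. (l ! k, l ! Suc k)"])
    show "inj_on (\<lambda>k. (l ! k, l ! Suc k)) good"
    proof (rule inj_onI)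
      fix i j assume "i \<in> good" "j \<in> good" "(l ! i, l ! Suc i) = (l ! j, l ! Suc j)"
      then show "i = j" using lless[of i j] lless[of j i]
        by (cases i j rule: linorder_cases) (auto simp: good_def)
    qed
    show "(\<lambda>k. (l ! k, l ! Suc k)) ` good \<subseteq> close_pairs t A B x"
      using lin lless by (force simp: good_def badf_def badg_def close_pairs_def P_def f_def g_def)
  qed (use fin finite_close_pairs in auto)
  ultimately show ?thesis by linarith
qed

lemma finite_difference_set [simp]:
  assumes "finite A" "finite B" shows "finite (difference_set A B)"
proof -
  have "difference_set A B = (\<lambda>(a, b). a - b) ` (A \<times> B)" by (auto simp: difference_set_def)
  then show ?thesis using assms by simp
qed

lemma difference_set_if_fibre: "b \<in> B \<Longrightarrow> b + x \<in> A \<Longrightarrow> x \<in> difference_set A B"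
  unfolding difference_set_def by (metis (mono_tags, lifting) add_diff_cancel_left' mem_Collect_eq)

lemma sum_card_fibre:
  assumes "finite A" "finite B"
  shows "(\<Sum>x\<in>difference_set A B. card (fibre A B x)) = card A * card B"
proof -
  have "bij_betw (\<lambda>(x, b). (b + x, b)) (SIGMA x:difference_set A B. fibre A B x) (A \<times> B)"
    by (rule bij_betw_byWitness[where f' = "\<lambda>(a, b). (a - b, b)"])
      (auto simp: fibre_def difference_set_def)
  from bij_betw_same_card[OF this] show ?thesis using assms by (simp add: card_cartesian_product)
qed

text \<open>
  Count the triples of a popular \<open>x\<close> and a close pair of its fibre. By
  \<open>many_close_pairs\<close> each popular \<open>x\<close> contributes at least \<open>t / 4\<close>. Conversely, such a triple
  is determined by the smaller element of the pair and the two position gaps: the gap in \<open>B\<close>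
  gives the second element, and then \<open>convex_difference_determines\<close> locates the translated
  pair in \<open>A\<close>, which reveals \<open>x\<close>. The gaps are at most \<open>4 |B| / t\<close> and \<open>4 |A| / t\<close>, so there
  are at most \<open>16 |A| |B|\<^sup>2 / t\<^sup>2\<close> triples.
\<close>

lemma convex_card_popular_le:
  assumes A: "finite A" "convex_finite_set A" and B: "finite B" and t: "1 \<le> t"
  shows "t ^ 3 * card {x \<in> difference_set A B. t \<le> card (fibre A B x)} \<le> 64 * card A * card B ^ 2"
proof -
  define X where "X = {x \<in> difference_set A B. t \<le> card (fibre A B x)}"
  have finX: "finite X" using A B by (simp add: X_def)
  show ?thesis
  proof (cases "t = 1")
    case True
    \<comment> \<open>A fibre with a single element has no pairs; here the trivial bound \<open>|A| |B|\<close> suffices.\<close>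
    have "card X \<le> (\<Sum>x\<in>X. card (fibre A B x))"
      using sum_mono[of X "\<lambda>_. 1" "\<lambda>x. card (fibre A B x)"] by (simp add: X_def True)
    also have "\<dots> \<le> card A * card B"
      unfolding sum_card_fibre[OF A(1) B, symmetric] using A B
      by (intro sum_mono2) (auto simp: X_def)
    also have "\<dots> \<le> (64 * card A) * card B ^ 2"
      by (intro mult_le_mono) (simp_all add: power2_eq_square)
    finally show ?thesis using True by (simp add: X_def)
  next
    case False
    then have t2: "2 \<le> t" using t by simp
    define L where "L = 4 * card B div t"
    define M where "M = 4 * card A div t"
    define F where "F = (\<lambda>(x, b, b').
      (b, position B b' - position B b, position A (b' + x) - position A (b + x)))"
    have "card (SIGMA x:X. close_pairs t A B x) \<le> card (B \<times> {1..L} \<times> {1..M})"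
    proof (rule card_inj_on_le[of F])
      show "F ` (SIGMA x:X. close_pairs t A B x) \<subseteq> B \<times> {1..L} \<times> {1..M}"
        using A B by (auto simp: F_def close_pairs_def fibre_def L_def M_def Suc_le_eq
          intro!: position_less)
      show "inj_on F (SIGMA x:X. close_pairs t A B x)"
      proof (rule inj_onI)
        fix v w
        assume vw: "v \<in> (SIGMA x:X. close_pairs t A B x)" "w \<in> (SIGMA x:X. close_pairs t A B x)"
          "F v = F w"
        obtain x b b' where v: "v = (x, b, b')" by (cases v)
        obtain y c c' where w: "w = (y, c, c')" by (cases w)
        have p: "(b, b') \<in> close_pairs t A B x" and q: "(c, c') \<in> close_pairs t A B y"
          and eq: "F (x, b, b') = F (y, c, c')"
          using vw v w by auto
        have bc: "b = c" using eq by (simp add: F_def)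
        have "position B b \<le> position B b'" "position B c \<le> position B c'"
          using p q B by (auto simp: close_pairs_def intro!: position_mono)
        moreover have "position B b' - position B b = position B c' - position B c"
          using eq by (auto simp: F_def)
        ultimately have "position B b' = position B c'" by (metis bc eq_diff_iff)
        then have bc': "c' = b'"
          using p q B position_inj[of B b' c'] by (auto simp: close_pairs_def fibre_def)
        have "b + x = b + y"
          by (rule convex_difference_determines[OF A(2), of _ "b' + x" _ "b' + y"])
            (use p q eq bc bc' in \<open>auto simp: close_pairs_def fibre_def F_def\<close>)
        then show "v = w" using v w bc bc' by simp
      qed
    qed (use B in auto)
    then have pairs: "(\<Sum>x\<in>X. card (close_pairs t A B x)) \<le> card B * (L * M)"
      using finX B by (simp add: card_cartesian_product finite_close_pairs)
    have "t * card X \<le> (\<Sum>x\<in>X. 4 * card (close_pairs t A B x))"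
      using sum_mono[of X "\<lambda>_. t" "\<lambda>x. 4 * card (close_pairs t A B x)"]
        many_close_pairs[OF A(1) B t2] by (simp add: X_def mult.commute)
    also have "\<dots> \<le> 4 * (card B * (L * M))" using pairs by (simp add: sum_distrib_left[symmetric])
    finally have "t\<^sup>2 * (t * card X) \<le> t\<^sup>2 * (4 * (card B * (L * M)))" by (rule mult_le_mono2)
    also have "\<dots> = 4 * card B * ((t * L) * (t * M))" by (simp add: power2_eq_square algebra_simps)
    also have "\<dots> \<le> 4 * card B * ((4 * card B) * (4 * card A))"
      unfolding L_def M_def by (intro mult_le_mono le_refl times_div_less_eq_dividend)
    finally show ?thesis by (simp add: X_def power2_eq_square power3_eq_cube algebra_simps)
  qed
qed


section \<open>Moments of the number of representations\<close>

text \<open>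
  Summation by layers, the discrete form of integrating a distribution function. It turns the
  bound on the number of popular differences into bounds on moments.
\<close>

lemma sum_layers:
  fixes h :: "nat \<Rightarrow> real" and r :: "'a \<Rightarrow> nat"
  assumes "finite X" "\<And>x. x \<in> X \<Longrightarrow> r x \<le> N"
  shows "(\<Sum>x\<in>X. \<Sum>t=1..r x. h t) = (\<Sum>t=1..N. h t * card {x \<in> X. t \<le> r x})"
proof -
  have "(\<Sum>x\<in>X. \<Sum>t=1..r x. h t) = (\<Sum>x\<in>X. \<Sum>t=1..N. if t \<le> r x then h t else 0)"
  proof (rule sum.cong[OF refl])
    fix x assume "x \<in> X"
    then have "{1..r x} = {t \<in> {1..N}. t \<le> r x}" using assms(2)[of x] by auto
    then show "(\<Sum>t=1..r x. h t) = (\<Sum>t=1..N. if t \<le> r x then h t else 0)"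
      by (simp only: sum.inter_filter finite_atLeastAtMost)
  qed
  also have "\<dots> = (\<Sum>t=1..N. \<Sum>x\<in>X. if t \<le> r x then h t else 0)" by (rule sum.swap)
  also have "\<dots> = (\<Sum>t=1..N. h t * card {x \<in> X. t \<le> r x})"
    using assms(1) by (simp add: sum.inter_filter[symmetric] mult.commute)
  finally show ?thesis .
qed

lemma square_le_layers: "real m ^ 2 \<le> (\<Sum>t=1..m. 2 * real t)"
  by (induction m) (auto simp: power2_eq_square algebra_simps)

lemma cube_le_layers: "real m ^ 3 \<le> (\<Sum>t=1..m. 3 * real t ^ 2)"
  by (induction m) (auto simp: power2_eq_square power3_eq_cube algebra_simps)

text \<open>
  By layers the third moment is at most \<open>\<Sum>\<^sub>t 3 t\<^sup>2 \<cdot> 64 n\<^sup>3 / t\<^sup>3\<close>, a harmonic sum. This is the only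
  source of logarithms. For \<open>n \<ge> 2\<close> the additive constant in \<open>harm n \<le> 1 + ln n\<close> is absorbed
  by \<open>ln n \<ge> ln 2 \<ge> 2/3\<close>.
\<close>

lemma convex_third_moment:
  assumes A: "finite A" "convex_finite_set A" and n: "2 \<le> card A"
  shows "(\<Sum>x\<in>difference_set A A. real (card (fibre A A x)) ^ 3)
    \<le> 480 * real (card A) ^ 3 * ln (real (card A))"
proof -
  define n where "n = card A"
  define D where "D = difference_set A A"
  define r where "r x = card (fibre A A x)" for x
  have r_le: "r x \<le> n" for x
    unfolding r_def n_def using A by (intro card_mono) (auto simp: fibre_def)
  have "(\<Sum>x\<in>D. real (r x) ^ 3) \<le> (\<Sum>x\<in>D. \<Sum>t=1..r x. 3 * real t ^ 2)"
    by (intro sum_mono cube_le_layers)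
  also have "\<dots> = (\<Sum>t=1..n. 3 * real t ^ 2 * card {x \<in> D. t \<le> r x})"
    using A r_le by (intro sum_layers) (auto simp: D_def)
  also have "\<dots> \<le> (\<Sum>t=1..n. 192 * real n ^ 3 * inverse (real t))"
  proof (rule sum_mono)
    fix t assume "t \<in> {1..n}"
    then have t: "1 \<le> t" by simp
    have "t ^ 3 * card {x \<in> D. t \<le> r x} \<le> 64 * n * n ^ 2"
      using convex_card_popular_le[OF A A(1) t] by (simp add: D_def r_def n_def)
    then have "real (t ^ 3 * card {x \<in> D. t \<le> r x}) \<le> real (64 * n * n ^ 2)"
      by (simp only: of_nat_le_iff)
    then show "3 * real t ^ 2 * card {x \<in> D. t \<le> r x} \<le> 192 * real n ^ 3 * inverse (real t)"
      using t by (simp add: field_simps power2_eq_square power3_eq_cube)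
  qed
  also have "\<dots> = 192 * real n ^ 3 * harm n" by (simp add: harm_def sum_distrib_left)
  also have "\<dots> \<le> 192 * real n ^ 3 * (5 / 2 * ln (real n))"
  proof (intro mult_left_mono)
    have "ln 2 \<le> ln (real n)" using n by (simp add: n_def)
    then have "1 \<le> 3 / 2 * ln (real n)" using ln2_ge_two_thirds by simp
    then show "harm n \<le> 5 / 2 * ln (real n)"
      using euler_mascheroni_sequence_decreasing[of 1 n] n by (simp add: n_def harm_def)
  qed simp
  finally show ?thesis by (simp add: D_def r_def n_def mult_ac)
qed

text \<open>
  Up to the threshold \<open>m\<close> the constant bound is summed, beyond it the tail
  \<open>\<Sum>\<^sub>t q / t\<^sup>2 \<le> q / m\<close>, which is compared with a telescoping series.
\<close>

lemma sum_le_two_regimes: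
  fixes g :: "nat \<Rightarrow> real"
  assumes p: "\<And>t. 1 \<le> t \<Longrightarrow> g t \<le> p" and q: "\<And>t. 1 \<le> t \<Longrightarrow> g t * real t ^ 2 \<le> q"
    and nonneg: "0 \<le> p" "0 \<le> q" and m: "1 \<le> m"
  shows "(\<Sum>t=1..N. g t) \<le> p * real m + q / real m"
proof -
  have low: "(\<Sum>t=1..N. g t) \<le> p * real N" for N
    using sum_bounded_above[of "{1..N}" g p] p by (simp add: mult.commute)
  show ?thesis
  proof (cases "N \<le> m")
    case True
    have "p * real N \<le> p * real m" using True nonneg by (intro mult_left_mono) auto
    then show ?thesis using low[of N] nonneg m
      by (smt (verit) divide_nonneg_nonneg of_nat_0_le_iff)
  next
    case False
    have "(\<Sum>t=1..N. g t) \<le> p * real m + q / real m - q / real N" if "m \<le> N" for N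
      using that
    proof (induction N rule: dec_induct)
      case base
      show ?case using low[of m] by simp
    next
      case (step k)
      have "g (Suc k) \<le> q / real (Suc k) ^ 2" using q[of "Suc k"] by (simp add: field_simps)
      also have "\<dots> \<le> q / (real k * real (Suc k))"
        using nonneg m step by (intro divide_left_mono) (auto simp: power2_eq_square)
      also have "\<dots> = q / real k - q / real (Suc k)"
        using m step by (simp add: field_simps)
      finally show ?case using step.IH by simp
    qed
    from this[of N] show ?thesis using False nonneg
      by (smt (verit) divide_nonneg_nonneg of_nat_0_le_iff nat_le_linear)
  qed
qed

text \<open>
  In the layer sum with terms \<open>2 t |{x. r(x) \<ge> t}|\<close> the trivial bound \<open>|A| |B| / t\<close> on the
  number of \<open>x\<close> is the better one for small \<open>t\<close>, and the squeezing bound for large \<open>t\<close>. Up to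
  constants they agree at \<open>t = sqrt |B|\<close>, where the sum is split.
\<close>

lemma convex_second_moment:
  assumes A: "finite A" "convex_finite_set A" and B: "finite B"
  shows "(\<Sum>x\<in>difference_set A B. real (card (fibre A B x)) ^ 2)
    \<le> 132 * real (card A) * real (card B) * sqrt (real (card B))"
proof (cases "B = {}")
  case True
  then show ?thesis by (simp add: difference_set_def)
next
  case False
  define D where "D = difference_set A B"
  define r where "r x = card (fibre A B x)" for x
  define a where "a = real (card A)"
  define b where "b = real (card B)"
  define g where "g t = 2 * real t * card {x \<in> D. t \<le> r x}" for t
  define m where "m = nat \<lceil>sqrt b\<rceil>"
  have b: "1 \<le> b" using False B by (simp add: b_def Suc_le_eq card_gt_0_iff)
  then have sb: "1 \<le> sqrt b" by simp
  have m: "1 \<le> m" "sqrt b \<le> real m" "real m \<le> 2 * sqrt b"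
    using sb unfolding m_def by linarith+
  have m_pos: "0 < real m" using m(1) by simp
  have r_le: "r x \<le> card B" for x
    unfolding r_def using B by (intro card_mono) (auto simp: fibre_def)
  have "(\<Sum>x\<in>D. real (r x) ^ 2) \<le> (\<Sum>x\<in>D. \<Sum>t=1..r x. 2 * real t)"
    by (intro sum_mono square_le_layers)
  also have "\<dots> = (\<Sum>t=1..card B. g t)"
    unfolding g_def using A B r_le by (intro sum_layers) (auto simp: D_def)
  also have "\<dots> \<le> 2 * a * b * real m + 128 * a * b ^ 2 / real m"
  proof (rule sum_le_two_regimes)
    fix t :: nat assume t: "1 \<le> t"
    have "t * card {x \<in> D. t \<le> r x} \<le> (\<Sum>x\<in>{x \<in> D. t \<le> r x}. r x)"
      using sum_mono[of "{x \<in> D. t \<le> r x}" "\<lambda>_. t" r] by (simp add: mult.commute)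
    also have "\<dots> \<le> card A * card B"
      unfolding sum_card_fibre[OF A(1) B, symmetric] r_def using A B
      by (intro sum_mono2) (auto simp: D_def)
    finally have "real (t * card {x \<in> D. t \<le> r x}) \<le> real (card A * card B)"
      by (simp only: of_nat_le_iff)
    then show "g t \<le> 2 * a * b" by (simp add: g_def a_def b_def)
    have "t ^ 3 * card {x \<in> D. t \<le> r x} \<le> 64 * card A * card B ^ 2"
      using convex_card_popular_le[OF A B t] by (simp add: D_def r_def)
    then have "real (t ^ 3 * card {x \<in> D. t \<le> r x}) \<le> real (64 * card A * card B ^ 2)"
      by (simp only: of_nat_le_iff)
    then show "g t * real t ^ 2 \<le> 128 * a * b ^ 2"
      by (simp add: g_def a_def b_def power2_eq_square power3_eq_cube algebra_simps)
  qed (use m b in \<open>auto simp: a_def\<close>)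
  also have "\<dots> \<le> 2 * a * b * (2 * sqrt b) + 128 * a * b ^ 2 / sqrt b"
  proof (rule add_mono)
    show "2 * a * b * real m \<le> 2 * a * b * (2 * sqrt b)"
      using m(3) b by (intro mult_left_mono) (auto simp: a_def)
    have "0 < sqrt b * real m" using m_pos sb by (intro mult_pos_pos) auto
    then show "128 * a * b ^ 2 / real m \<le> 128 * a * b ^ 2 / sqrt b"
      using m(2) by (intro divide_left_mono) (auto simp: a_def mult.commute)
  qed
  also have "128 * a * b ^ 2 / sqrt b = 128 * a * b * sqrt b"
    using b real_sqrt_mult_self[of b] by (simp add: field_simps power2_eq_square)
  finally show ?thesis by (simp add: D_def r_def a_def b_def)
qed

section \<open>Additive energy\<close>

text \<open>
  The additive energy of \<open>A\<close> and \<open>B\<close>: the number of solutions of \<open>a - a' = b - b'\<close>.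
\<close>

definition energy :: "real set \<Rightarrow> real set \<Rightarrow> nat" where
  "energy A B = (\<Sum>d\<in>difference_set A A. card (fibre A A d) * card (fibre B B d))"

text \<open>
  Rearranging \<open>a' - a = b' - b\<close> into \<open>a' - b' = a - b\<close>.
\<close>

lemma energy_eq_sum_squares:
  assumes "finite A" "finite B"
  shows "energy A B = (\<Sum>x\<in>difference_set A B. card (fibre A B x) ^ 2)"
proof -
  have "bij_betw (\<lambda>(d, a, b). (a - b, b, b + d))
      (SIGMA d:difference_set A A. fibre A A d \<times> fibre B B d)
      (SIGMA x:difference_set A B. fibre A B x \<times> fibre A B x)"
    by (rule bij_betw_byWitness[where f' = "\<lambda>(x, b, b'). (b' - b, b + x, b)"])
      (auto intro: difference_set_if_fibre simp: fibre_def algebra_simps)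
  from bij_betw_same_card[OF this] show ?thesis
    using assms by (simp add: energy_def card_cartesian_product power2_eq_square)
qed

text \<open>
  Negation turns a pair \<open>(b, b + d)\<close> in \<open>B\<close> into a pair \<open>(- b - d, - b)\<close> with the same
  difference. This invariance transfers the Cauchy-Schwarz bound from \<open>A - B\<close> to \<open>A + B\<close>.
\<close>

lemma energy_minus:
  assumes "finite B"
  shows "energy A (uminus ` B) = energy A B"
proof -
  have "card (fibre (uminus ` B) (uminus ` B) d) = card (fibre B B d)" for d
  proof (rule bij_betw_same_card)
    show "bij_betw (\<lambda>b. - b - d) (fibre (uminus ` B) (uminus ` B) d) (fibre B B d)"
      by (rule bij_betw_byWitness[where f' = "\<lambda>b. - b - d"])
        (auto simp: fibre_def image_iff algebra_simps)
  qed
  then show ?thesis by (simp add: energy_def)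
qed

lemma card_square_le_difference_energy:
  assumes "finite A" "finite B"
  shows "real (card A * card B) ^ 2 \<le> real (card (difference_set A B)) * real (energy A B)"
  using Cauchy_Schwarz_ineq_sum[of "\<lambda>_. 1" "\<lambda>x. real (card (fibre A B x))" "difference_set A B"]
  unfolding sum_card_fibre[OF assms, symmetric] energy_eq_sum_squares[OF assms] by simp

lemma card_square_le_sum_energy:
  assumes "finite A" "finite B"
  shows "real (card A * card B) ^ 2 \<le> real (card (A + B)) * real (energy A B)"
proof -
  have "difference_set A (uminus ` B) = A + B"
    by (force simp: difference_set_def set_plus_def)
  moreover have "card (uminus ` B) = card B" by (simp add: card_image)
  ultimately show ?thesis
    using card_square_le_difference_energy[of A "uminus ` B"] energy_minus[of B A] assms by simp
qed

text \<open>
  Both sides count configurations in \<open>A\<close>. On the left there are a difference \<open>d\<close>, one pair in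
  \<open>A\<close> with this difference, and a second such pair \<open>(b, b + d)\<close> whose translate by \<open>s\<close> lies in
  \<open>A\<close> as well. That translate is a third pair with difference \<open>d\<close>, and \<open>s\<close> can be read off
  from the second and third pairs.
\<close>

lemma sum_energy_fibre_le:
  assumes "finite A"
  shows "(\<Sum>s\<in>difference_set A A. energy A (fibre A A s))
    \<le> (\<Sum>d\<in>difference_set A A. card (fibre A A d) ^ 3)"
proof -
  let ?D = "difference_set A A"
  let ?A = "fibre A A"
  have "(\<Sum>s\<in>?D. energy A (?A s))
      = (\<Sum>d\<in>?D. card (?A d) * (\<Sum>s\<in>?D. card (fibre (?A s) (?A s) d)))"
    unfolding energy_def by (subst sum.swap) (simp add: sum_distrib_left)
  also have "\<dots> \<le> (\<Sum>d\<in>?D. card (?A d) * card (?A d) ^ 2)"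
  proof (intro sum_mono mult_le_mono le_refl)
    fix d
    have "card (SIGMA s:?D. fibre (?A s) (?A s) d) \<le> card (?A d \<times> ?A d)"
      by (rule card_inj_on_le[of "\<lambda>(s, b). (b, b + s)"])
        (use assms in \<open>auto simp: inj_on_def fibre_def algebra_simps\<close>)
    then show "(\<Sum>s\<in>?D. card (fibre (?A s) (?A s) d)) \<le> card (?A d) ^ 2"
      using assms by (simp add: card_cartesian_product power2_eq_square)
  qed
  finally show ?thesis by (simp add: power2_eq_square power3_eq_cube mult.assoc)
qed

text \<open>
  If \<open>b\<close> and \<open>b + s\<close> lie in \<open>A\<close>, then \<open>a - b\<close> and \<open>a - b - s = a - (b + s)\<close> are both
  differences of elements of \<open>A\<close>: the Katz-Koester inclusion.
\<close>

lemma card_difference_fibre_le: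
  assumes "finite A"
  shows "card (difference_set A (fibre A A s))
    \<le> card (fibre (difference_set A A) (difference_set A A) s)"
proof (rule card_inj_on_le[of "\<lambda>y. y - s"])
  show "(\<lambda>y. y - s) ` difference_set A (fibre A A s)
      \<subseteq> fibre (difference_set A A) (difference_set A A) s"
  proof
    fix x assume "x \<in> (\<lambda>y. y - s) ` difference_set A (fibre A A s)"
    then obtain a b where ab: "a \<in> A" "b \<in> A" "b + s \<in> A" "x = a - b - s"
      by (auto simp: difference_set_def fibre_def)
    then have "x = a - (b + s)" "x + s = a - b" by simp_all
    with ab show "x \<in> fibre (difference_set A A) (difference_set A A) s"
      unfolding difference_set_def fibre_def by blast
  qed
qed (use assms in \<open>auto simp: inj_on_def\<close>)

lemma card_sum_fibre_le:
  assumes "finite A"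
  shows "card (A + fibre A A s) \<le> card (fibre (A + A) (A + A) s)"
proof (rule card_mono)
  show "A + fibre A A s \<subseteq> fibre (A + A) (A + A) s"
  proof
    fix y assume "y \<in> A + fibre A A s"
    then obtain a b where "a \<in> A" "b \<in> A" "b + s \<in> A" "y = a + b"
      by (auto simp: set_plus_def fibre_def)
    then show "y \<in> fibre (A + A) (A + A) s"
      using set_plus_intro[of a A b A] set_plus_intro[of a A "b + s" A]
      by (simp add: fibre_def add.assoc)
  qed
qed (use assms in \<open>simp add: finite_set_plus\<close>)

section \<open>The moment of order three halves\<close>

text \<open>
  Hoelder's inequality with exponents \<open>3/2\<close> and \<open>3\<close>. With \<open>P = \<Sum> f\<^sup>2 g\<close> and
  \<open>Q = \<Sum> f g\<^sup>2\<close>, the Cauchy-Schwarz inequality bounds \<open>P\<^sup>2\<close> by \<open>(\<Sum> f\<^sup>3) Q\<close> and, with \<open>f\<close> and \<open>g\<close>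
  exchanged, \<open>Q\<^sup>2\<close> by \<open>(\<Sum> g\<^sup>3) P\<close>; eliminating \<open>Q\<close> gives the claim.
\<close>

lemma Hoelder_three_halves:
  fixes f g :: "'a \<Rightarrow> real"
  assumes nonneg: "\<And>x. x \<in> X \<Longrightarrow> 0 \<le> f x" "\<And>x. x \<in> X \<Longrightarrow> 0 \<le> g x"
  shows "(\<Sum>x\<in>X. f x ^ 2 * g x) ^ 3 \<le> (\<Sum>x\<in>X. f x ^ 3) ^ 2 * (\<Sum>x\<in>X. g x ^ 3)"
proof -
  define P where "P = (\<Sum>x\<in>X. f x ^ 2 * g x)"
  define Q where "Q = (\<Sum>x\<in>X. f x * g x ^ 2)"
  define F where "F = (\<Sum>x\<in>X. f x ^ 3)"
  define G where "G = (\<Sum>x\<in>X. g x ^ 3)"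
  have nn: "0 \<le> P" "0 \<le> Q" "0 \<le> F" "0 \<le> G"
    unfolding P_def Q_def F_def G_def using nonneg by (auto intro!: sum_nonneg)
  have CS: "(\<Sum>x\<in>X. u x ^ 2 * v x) ^ 2 \<le> (\<Sum>x\<in>X. u x ^ 3) * (\<Sum>x\<in>X. u x * v x ^ 2)"
    if "\<And>x. x \<in> X \<Longrightarrow> 0 \<le> u x" for u v :: "'a \<Rightarrow> real"
  proof -
    have "(\<Sum>x\<in>X. (u x * sqrt (u x)) * (sqrt (u x) * v x)) ^ 2
        \<le> (\<Sum>x\<in>X. (u x * sqrt (u x)) ^ 2) * (\<Sum>x\<in>X. (sqrt (u x) * v x) ^ 2)"
      by (rule Cauchy_Schwarz_ineq_sum)
    moreover have "(\<Sum>x\<in>X. (u x * sqrt (u x)) * (sqrt (u x) * v x)) = (\<Sum>x\<in>X. u x ^ 2 * v x)"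
      using that by (intro sum.cong) (auto simp: power2_eq_square algebra_simps)
    moreover have "(\<Sum>x\<in>X. (u x * sqrt (u x)) ^ 2) = (\<Sum>x\<in>X. u x ^ 3)"
      using that by (intro sum.cong) (auto simp: power_mult_distrib power2_eq_square power3_eq_cube)
    moreover have "(\<Sum>x\<in>X. (sqrt (u x) * v x) ^ 2) = (\<Sum>x\<in>X. u x * v x ^ 2)"
      using that by (intro sum.cong) (auto simp: power_mult_distrib)
    ultimately show ?thesis by simp
  qed
  have PQ: "P ^ 2 \<le> F * Q" using CS[of f g] nonneg by (simp add: P_def Q_def F_def)
  have QP: "Q ^ 2 \<le> G * P"
    using CS[of g f] nonneg by (simp add: P_def Q_def G_def mult.commute)
  have "P * P ^ 3 = (P ^ 2) ^ 2" by (simp add: eval_nat_numeral)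
  also have "\<dots> \<le> (F * Q) ^ 2" using PQ by (intro power_mono) auto
  also have "\<dots> = F ^ 2 * Q ^ 2" by (simp add: power_mult_distrib)
  also have "\<dots> \<le> F ^ 2 * (G * P)" using QP by (intro mult_left_mono) auto
  finally have "P * P ^ 3 \<le> P * (F ^ 2 * G)" by (simp add: mult_ac)
  then have "P ^ 3 \<le> F ^ 2 * G"
    using nn by (cases "P = 0") (auto simp: mult_le_cancel_left)
  then show ?thesis by (simp add: P_def F_def G_def)
qed

text \<open>
  The hypothesis gives \<open>n r(s) \<le> sqrt (r\<^bsub>V-V\<^esub>(s) E(A, A\<^sub>s))\<close>. Multiplying by \<open>sqrt (r(s))\<close>, summing
  over \<open>s\<close> and applying the Cauchy-Schwarz inequality separates \<open>\<Sum>\<^sub>s E(A, A\<^sub>s)\<close>, which is at most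
  the third moment, from \<open>\<Sum>\<^sub>s r(s) r\<^bsub>V-V\<^esub>(s) = E(A, V)\<close>. The hypothesis is satisfied by the
  difference set and by the sumset, which is why \<open>V\<close> is kept general.
\<close>

lemma three_halves_moment_le:
  fixes V :: "real set"
  assumes A: "finite A"
    and V: "\<And>s. s \<in> difference_set A A \<Longrightarrow>
      real (card A * card (fibre A A s)) ^ 2 \<le> real (card (fibre V V s)) * real (energy A (fibre A A s))"
  shows "real (card A) ^ 2 * (\<Sum>s\<in>difference_set A A. sqrt (card (fibre A A s)) ^ 3) ^ 2
    \<le> (\<Sum>s\<in>difference_set A A. real (card (fibre A A s)) ^ 3) * real (energy A V)"
proof -
  define D where "D = difference_set A A"
  define r where "r s = real (card (fibre A A s))" for s
  define v where "v s = real (card (fibre V V s))" for s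
  define e where "e s = real (energy A (fibre A A s))" for s
  have nn: "0 \<le> r s" "0 \<le> v s" "0 \<le> e s" for s by (auto simp: r_def v_def e_def)
  have "card A * (\<Sum>s\<in>D. sqrt (r s) ^ 3) \<le> (\<Sum>s\<in>D. sqrt (e s) * sqrt (r s * v s))"
    unfolding sum_distrib_left
  proof (rule sum_mono)
    fix s assume "s \<in> D"
    then have "(card A * r s) ^ 2 \<le> v s * e s"
      using V[of s] by (simp add: D_def r_def v_def e_def)
    then have "card A * r s \<le> sqrt (v s * e s)" by (rule real_le_rsqrt)
    then have "sqrt (r s) * (card A * r s) \<le> sqrt (r s) * sqrt (v s * e s)"
      by (rule mult_left_mono) (simp add: nn)
    then show "card A * sqrt (r s) ^ 3 \<le> sqrt (e s) * sqrt (r s * v s)"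
      using nn by (simp add: power3_eq_cube real_sqrt_mult mult_ac)
  qed
  then have "(card A * (\<Sum>s\<in>D. sqrt (r s) ^ 3)) ^ 2 \<le> (\<Sum>s\<in>D. sqrt (e s) * sqrt (r s * v s)) ^ 2"
    by (rule power_mono) (auto intro!: sum_nonneg mult_nonneg_nonneg simp: nn)
  also have "\<dots> \<le> (\<Sum>s\<in>D. sqrt (e s) ^ 2) * (\<Sum>s\<in>D. sqrt (r s * v s) ^ 2)"
    by (rule Cauchy_Schwarz_ineq_sum)
  also have "\<dots> = (\<Sum>s\<in>D. e s) * real (energy A V)"
    by (simp add: nn energy_def D_def r_def v_def)
  also have "\<dots> \<le> (\<Sum>s\<in>D. r s ^ 3) * real (energy A V)"
    using sum_energy_fibre_le[OF A] unfolding D_def e_def r_def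
    by (intro mult_right_mono) (simp_all flip: of_nat_sum of_nat_power)
  finally show ?thesis by (simp add: power_mult_distrib D_def r_def)
qed

lemma convex_three_halves_moment:
  fixes V :: "real set"
  assumes A: "finite A" "convex_finite_set A" "2 \<le> card A" and fV: "finite V"
    and V: "\<And>s. s \<in> difference_set A A \<Longrightarrow>
      real (card A * card (fibre A A s)) ^ 2 \<le> real (card (fibre V V s)) * real (energy A (fibre A A s))"
  shows "(\<Sum>s\<in>difference_set A A. sqrt (card (fibre A A s)) ^ 3) ^ 2
    \<le> 63360 * real (card A) ^ 2 * ln (card A) * (card V * sqrt (card V))"
proof -
  define n where "n = real (card A)"
  define T where "T = (\<Sum>s\<in>difference_set A A. sqrt (card (fibre A A s)) ^ 3)"
  have n: "2 \<le> n" using A by (simp add: n_def)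
  have "n ^ 2 * T ^ 2
      \<le> (\<Sum>s\<in>difference_set A A. real (card (fibre A A s)) ^ 3) * real (energy A V)"
    unfolding n_def T_def using A(1) V by (rule three_halves_moment_le)
  also have "\<dots> \<le> (480 * n ^ 3 * ln n) * (132 * n * card V * sqrt (card V))"
    using convex_third_moment[OF A] convex_second_moment[OF A(1,2) fV] n
    unfolding energy_eq_sum_squares[OF A(1) fV] n_def by (intro mult_mono) (auto intro!: sum_nonneg)
  also have "\<dots> = n ^ 2 * (63360 * n ^ 2 * ln n * (card V * sqrt (card V)))"
    by (simp add: power2_eq_square power3_eq_cube)
  finally show ?thesis using n by (simp add: n_def T_def)
qed


section \<open>The three inequalities\<close>

text \<open>
  Since \<open>K \<ge> 1\<close> and \<open>p \<ge> 1\<close>, taking the \<open>p\<close>-th root of \<open>K\<close> is avoided by the cruder bound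
  \<open>K powr (1 / p) \<le> K\<close>; one constant then serves all three inequalities.
\<close>

lemma powr_solve:
  fixes n L V K :: real
  assumes pos: "0 < n" "0 < L" "0 < V" and K: "1 \<le> K" and p: "1 \<le> p"
    and le: "n powr \<alpha> \<le> K * L powr \<beta> * V powr p"
  shows "n powr (\<alpha> / p) * L powr (- \<beta> / p) \<le> K * V"
proof -
  have "n powr (\<alpha> / p) = (n powr \<alpha>) powr (1 / p)" by (simp add: powr_powr)
  also have "\<dots> \<le> (K * L powr \<beta> * V powr p) powr (1 / p)"
    using le p by (intro powr_mono2) auto
  also have "\<dots> = K powr (1 / p) * L powr (\<beta> / p) * V"
    using p pos K by (simp add: powr_mult powr_powr)
  also have "\<dots> \<le> K * L powr (\<beta> / p) * V"
    using powr_mono[of "1 / p" 1 K] K p pos by (intro mult_right_mono) auto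
  finally have "n powr (\<alpha> / p) * L powr (- \<beta> / p)
      \<le> (K * L powr (\<beta> / p) * V) * L powr (- \<beta> / p)"
    by (intro mult_right_mono) auto
  also have "\<dots> = K * V" using pos by (simp add: powr_minus field_simps)
  finally show ?thesis .
qed

text \<open>
  The three inequalities before roots are taken. Each one confronts an upper bound for
  \<open>T\<^sup>2\<close>, obtained from \<open>V = A - A\<close> or \<open>V = A + A\<close>, with a lower bound from Hoelder's
  inequality. The latter is applied with \<open>f = sqrt r\<close> and with \<open>g = 1\<close> (giving \<open>lower_D\<close>) or
  \<open>g = r\<close> (giving \<open>lower_E\<close>).
\<close>

lemma convex_sumset_difference_set_bounds:
  fixes A :: "real set"
  assumes A: "finite A" "convex_finite_set A" "2 \<le> card A"
  defines "n \<equiv> real (card A)"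
    and "D \<equiv> real (card (difference_set A A))"
    and "S \<equiv> real (card (A + A))"
  shows "n ^ 4 \<le> 63360 * ln n * (D ^ 2 * sqrt D)"
    and "n ^ 8 \<le> 63360 ^ 2 * (S ^ 3 * D ^ 2 * ln n ^ 2)"
    and "n ^ 7 \<le> 480 * 63360 * ln n ^ 2 * (S ^ 4 * sqrt S)"
proof -
  let ?D = "difference_set A A"
  let ?S = "A + A"
  define r where "r s = real (card (fibre A A s))" for s
  define T where "T = (\<Sum>s\<in>?D. sqrt (r s) ^ 3)"
  define E where "E = real (energy A A)"
  define L where "L = ln n"
  have n: "2 \<le> n" using A(3) by (simp add: n_def)
  have L: "0 < L" using n by (simp add: L_def)
  have nn: "0 \<le> D" "0 \<le> S" by (simp_all add: D_def S_def)
  have finS: "finite ?S" using A(1) by (simp add: finite_set_plus)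
  have upper_D: "T ^ 2 \<le> 63360 * n ^ 2 * L * (D * sqrt D)"
    unfolding T_def n_def D_def L_def r_def
  proof (rule convex_three_halves_moment[OF A])
    fix s
    have "real (card A * card (fibre A A s)) ^ 2
        \<le> real (card (difference_set A (fibre A A s))) * real (energy A (fibre A A s))"
      using A(1) by (intro card_square_le_difference_energy) auto
    also have "\<dots> \<le> real (card (fibre ?D ?D s)) * real (energy A (fibre A A s))"
      using card_difference_fibre_le[OF A(1)] by (intro mult_right_mono) auto
    finally show "real (card A * card (fibre A A s)) ^ 2
        \<le> real (card (fibre ?D ?D s)) * real (energy A (fibre A A s))" .
  qed (use A in auto)
  have upper_S: "T ^ 2 \<le> 63360 * n ^ 2 * L * (S * sqrt S)"
    unfolding T_def n_def S_def L_def r_def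
  proof (rule convex_three_halves_moment[OF A])
    fix s
    have "real (card A * card (fibre A A s)) ^ 2
        \<le> real (card (A + fibre A A s)) * real (energy A (fibre A A s))"
      using A(1) by (intro card_square_le_sum_energy) auto
    also have "\<dots> \<le> real (card (fibre ?S ?S s)) * real (energy A (fibre A A s))"
      using card_sum_fibre_le[OF A(1)] by (intro mult_right_mono) auto
    finally show "real (card A * card (fibre A A s)) ^ 2
        \<le> real (card (fibre ?S ?S s)) * real (energy A (fibre A A s))" .
  qed (use finS in auto)
  have lower_D: "n ^ 6 \<le> T ^ 2 * D"
  proof -
    have "(\<Sum>s\<in>?D. r s) = n ^ 2"
      using sum_card_fibre[OF A(1) A(1)]
      unfolding r_def n_def by (simp add: power2_eq_square flip: of_nat_sum of_nat_mult)
    moreover have "(\<Sum>s\<in>?D. sqrt (r s) ^ 2 * 1) ^ 3 \<le> T ^ 2 * (\<Sum>s\<in>?D. 1 ^ 3)"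
      unfolding T_def by (rule Hoelder_three_halves) (auto simp: r_def)
    ultimately have "(n ^ 2) ^ 3 \<le> T ^ 2 * D" by (simp add: r_def D_def)
    then show ?thesis by (simp flip: power_mult)
  qed
  have lower_E: "E ^ 3 \<le> T ^ 2 * (480 * n ^ 3 * L)"
  proof -
    have "E = (\<Sum>s\<in>?D. sqrt (r s) ^ 2 * r s)"
      by (simp add: E_def energy_def r_def)
    then have "E ^ 3 \<le> T ^ 2 * (\<Sum>s\<in>?D. r s ^ 3)"
      unfolding T_def by (simp only:, intro Hoelder_three_halves) (auto simp: r_def)
    also have "\<dots> \<le> T ^ 2 * (480 * n ^ 3 * L)"
      using convex_third_moment[OF A] by (intro mult_left_mono) (auto simp: r_def n_def L_def)
    finally show ?thesis .
  qed
  have SE: "n ^ 4 \<le> S * E"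
    using card_square_le_sum_energy[OF A(1) A(1)]
    by (simp add: n_def S_def E_def power2_eq_square eval_nat_numeral mult_ac)
  have DD: "n ^ 4 \<le> 63360 * L * (V * sqrt V) * D"
    if "T ^ 2 \<le> 63360 * n ^ 2 * L * (V * sqrt V)" for V
  proof -
    have "n ^ 2 * n ^ 4 = n ^ 6" by (simp flip: power_add)
    also have "\<dots> \<le> T ^ 2 * D" by (rule lower_D)
    also have "\<dots> \<le> (63360 * n ^ 2 * L * (V * sqrt V)) * D"
      using that nn by (intro mult_right_mono) auto
    also have "\<dots> = n ^ 2 * (63360 * L * (V * sqrt V) * D)" by (simp add: mult_ac)
    finally have "n ^ 2 * n ^ 4 \<le> n ^ 2 * (63360 * L * (V * sqrt V) * D)" .
    then show ?thesis by (rule mult_left_le_imp_le) (use n in simp)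
  qed
  show "n ^ 4 \<le> 63360 * ln n * (D ^ 2 * sqrt D)"
    using DD[OF upper_D] by (simp add: L_def power2_eq_square mult_ac)
  have sqrt_S: "sqrt S * (sqrt S * x) = S * x" for x
    using nn by (simp flip: mult.assoc)
  have "(n ^ 4) ^ 2 \<le> (63360 * L * (S * sqrt S) * D) ^ 2"
    using DD[OF upper_S] by (intro power_mono) auto
  then show "n ^ 8 \<le> 63360 ^ 2 * (S ^ 3 * D ^ 2 * ln n ^ 2)"
    by (simp add: power_mult_distrib L_def power2_eq_square power3_eq_cube mult_ac sqrt_S
        flip: power_mult)
  have "n ^ 5 * n ^ 7 = (n ^ 4) ^ 3" by (simp flip: power_add power_mult)
  also have "\<dots> \<le> (S * E) ^ 3" using SE by (intro power_mono) (use n in auto)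
  also have "\<dots> = S ^ 3 * E ^ 3" by (simp add: power_mult_distrib)
  also have "\<dots> \<le> S ^ 3 * (T ^ 2 * (480 * n ^ 3 * L))"
    using lower_E nn by (intro mult_left_mono) auto
  also have "\<dots> \<le> S ^ 3 * ((63360 * n ^ 2 * L * (S * sqrt S)) * (480 * n ^ 3 * L))"
    using upper_S nn n L by (intro mult_left_mono mult_right_mono) auto
  also have "\<dots> = n ^ 5 * (480 * 63360 * L ^ 2 * (S ^ 4 * sqrt S))"
    by (simp add: eval_nat_numeral mult_ac)
  finally have "n ^ 5 * n ^ 7 \<le> n ^ 5 * (480 * 63360 * L ^ 2 * (S ^ 4 * sqrt S))" .
  then have "n ^ 7 \<le> 480 * 63360 * L ^ 2 * (S ^ 4 * sqrt S)"
    by (rule mult_left_le_imp_le) (use n in simp)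
  then show "n ^ 7 \<le> 480 * 63360 * ln n ^ 2 * (S ^ 4 * sqrt S)" by (simp only: L_def)
qed

theorem theorem1:
  shows "\<exists>c::real. c > 0 \<and>
    (\<forall>A::real set. finite A \<longrightarrow> convex_finite_set A \<longrightarrow> card A \<ge> 2 \<longrightarrow>
       real (card (difference_set A A))
         \<ge> c * real (card A) powr (8/5) * ln (real (card A)) powr (-2/5) \<and>
       real (card (A + A))
         \<ge> c * real (card A) powr (14/9) * ln (real (card A)) powr (-2/3) \<and>
       real (card (A + A)) ^ 3 * real (card (difference_set A A)) ^ 2 * ln (real (card A)) ^ 2
         \<ge> c * real (card A) ^ 8)"
proof (intro exI[of _ "1 / 63360 ^ 2"] conjI allI impI)
  fix A :: "real set"
  assume A: "finite A" "convex_finite_set A" "2 \<le> card A"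
  define n where "n = real (card A)"
  define D where "D = real (card (difference_set A A))"
  define S where "S = real (card (A + A))"
  define L where "L = ln n"
  \<comment> \<open>The square comes from the mixed inequality, and it dominates the constants of the other two.\<close>
  define K :: real where "K = 63360 ^ 2"
  note bounds = convex_sumset_difference_set_bounds[OF A, folded n_def D_def S_def L_def]
  have n: "2 \<le> n" using A(3) by (simp add: n_def)
  have "2 / 3 \<le> ln (2 :: real)" by (rule ln2_ge_two_thirds)
  also have "\<dots> \<le> L" using n by (simp add: L_def)
  finally have L: "2 / 3 \<le> L" .
  have pos: "0 < D" "0 < S"
    using bounds(1,3) n
    by (auto simp: D_def S_def neq0_conv[symmetric] simp del: neq0_conv intro!: Nat.gr0I)
  have K: "1 \<le> K" "63360 \<le> K" "480 * 63360 * (3 / 2) \<le> K" by (simp_all add: K_def)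
  have "n ^ 4 \<le> K * L * (D ^ 2 * sqrt D)"
    using bounds(1) by (rule order_trans) (use K L pos in \<open>intro mult_right_mono; simp\<close>)
  also have "D ^ 2 * sqrt D = D powr (5 / 2)"
    using pos powr_add[of D 2 "1 / 2"] by (simp add: powr_half_sqrt powr_numeral)
  finally have "n powr 4 \<le> K * L powr 1 * D powr (5 / 2)"
    using n L by (simp add: powr_numeral)
  from powr_solve[OF _ _ pos(1) K(1) _ this] n L
  have "n powr (8 / 5) * L powr (- 2 / 5) \<le> K * D" by simp
  then show "1 / 63360 ^ 2 * real (card A) powr (8/5) * ln (real (card A)) powr (-2/5)
      \<le> real (card (difference_set A A))"
    by (simp add: n_def L_def D_def K_def field_simps)
  have "n ^ 7 \<le> K * L ^ 3 * (S ^ 4 * sqrt S)"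
    using bounds(3)
  proof (rule order_trans)
    \<comment> \<open>One more factor \<open>L \<ge> 2/3\<close> turns the exponent \<open>-4/9\<close> of the logarithm into \<open>-6/9 = -2/3\<close>.\<close>
    have "480 * 63360 * L ^ 2 \<le> 480 * 63360 * (3 / 2) * L ^ 3"
      using L mult_right_mono[of "1" "3 / 2 * L" "L ^ 2"]
      by (simp add: power2_eq_square power3_eq_cube mult_ac)
    also have "\<dots> \<le> K * L ^ 3" using K(3) L by (intro mult_right_mono) auto
    finally show "480 * 63360 * L ^ 2 * (S ^ 4 * sqrt S) \<le> K * L ^ 3 * (S ^ 4 * sqrt S)"
      using pos by (intro mult_right_mono) auto
  qed
  also have "S ^ 4 * sqrt S = S powr (9 / 2)"
    using pos powr_add[of S 4 "1 / 2"] by (simp add: powr_half_sqrt powr_numeral)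
  finally have "n powr 7 \<le> K * L powr 3 * S powr (9 / 2)"
    using n L by (simp add: powr_numeral)
  from powr_solve[OF _ _ pos(2) K(1) _ this] n L
  have "n powr (14 / 9) * L powr (- 2 / 3) \<le> K * S" by simp
  then show "1 / 63360 ^ 2 * real (card A) powr (14/9) * ln (real (card A)) powr (-2/3)
      \<le> real (card (A + A))"
    by (simp add: n_def L_def S_def K_def field_simps)
  show "1 / 63360 ^ 2 * real (card A) ^ 8
      \<le> real (card (A + A)) ^ 3 * real (card (difference_set A A)) ^ 2 * ln (real (card A)) ^ 2"
    using bounds(2) by (simp add: n_def L_def S_def D_def field_simps)
qed simp

end
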